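(* Let $n\geqslant 2$ and $m\geqslant 1$ be integers, and let $P_{n-1}$ denote the path graph on $n-1$ vertices. The number $p(2m)$ of closed walks of length $2m$ on $P_{n-1}$ is $$p(2m)=\begin{cases}\displaystyle 2n\Bigl(\binom{2m-1}{m-1}+\sum_{k=1}^{\lfloor m/n\rfloor}\binom{2m}{m-kn}\Bigr)-2^{2m}, & m\geqslant n,\\[2mm] \displaystyle 2n\binom{2m-1}{m-1}-2^{2m}, & m<n.\end{cases}$$
   Context: A walk of length $r$ in a graph is a sequence $(v_0,v_1,\dots,v_r)$ of vertices (not necessarily distinct) such that $v_{i-1}$ and $v_i$ are adjacent for each $i=1,\dots,r$; it is closed if $v_0=v_r$. The number of closed walks of length $r$ is the number of such sequences, i.e. the trace of $A^r$ where $A$ is the adjacency matrix. The path graph $P_{n-1}$ has vertices $1,\dots,n-1$ with $i$ adjacent to $j$ iff $|i-j|=1$. $\lfloor x\rfloor$ is the floor of $x$. *)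

theory Defs
  imports "Graph_Theory.Graph_Theory"
begin

text \<open>An undirected simple graph is a symmetric loop-free digraph (\<^locale>\<open>pair_graph\<close>).\<close>

definition path_graph :: "nat \<Rightarrow> nat pair_pre_digraph" where
  "path_graph k =
     \<lparr> pverts = {1..k},
       parcs = {(i, j). i \<in> {1..k} \<and> j \<in> {1..k} \<and> \<bar>int i - int j\<bar> = 1} \<rparr>"

text \<open>A walk is the list \<open>[v\<^sub>0, \<dots>, v\<^sub>r]\<close> of its vertices; \<^const>\<open>vwalk_length\<close> counts
  its \<open>r\<close> steps.  Closed walks with different starting points are different.\<close>

definition closed_walks :: "('a, 'b) pre_digraph \<Rightarrow> nat \<Rightarrow> 'a vwalk set" where
  "closed_walks G r = {w. vwalk w G \<and> vwalk_length w = r \<and> hd w = last w}"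

definition num_closed_walks :: "('a, 'b) pre_digraph \<Rightarrow> nat \<Rightarrow> nat" where
  "num_closed_walks G r = card (closed_walks G r)"

lemma pair_graph_path_graph: "pair_graph (path_graph k)"
proof
  show "finite (parcs (path_graph k))"
    by (rule finite_subset[of _ "{1..k} \<times> {1..k}"]) (auto simp: path_graph_def)
  show "symmetric (with_proj (path_graph k))"
    by (auto simp: symmetric_def arcs_ends_def arc_to_ends_def path_graph_def sym_def)
qed (auto simp: path_graph_def)

lemma finite_closed_walks:
  assumes "finite (verts G)"
  shows "finite (closed_walks G r)"
  by (rule finite_subset[OF _ finite_lists_length_le[OF assms, of "Suc r"]])
    (auto simp: closed_walks_def vwalk_def)

end

theory Submission
  imports Defs
begin

text \<open>By the reflection principle, the walks of length \<open>r\<close> from \<open>i\<close> to \<open>j\<close> staying strictly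
  between \<open>0\<close> and \<open>n\<close> number \<open>N\<^sub>r(j - i) - N\<^sub>r(j + i)\<close>, where \<open>N\<^sub>r(x)\<close> counts the
  unrestricted \<open>\<plusminus>1\<close> walks of length \<open>r\<close> with displacement congruent to \<open>x\<close> modulo \<open>2n\<close>: both sides satisfy
  the same recurrence in \<open>r\<close> with the same boundary values at \<open>i = 0\<close> and \<open>i = n\<close>.  Summing over
  \<open>i = j\<close> gives \<open>n N\<^sub>r(0) - (\<Sum>i<n. N\<^sub>r(2i))\<close>, and for \<open>r = 2m\<close> the last sum counts all
  \<open>2\<^sup>2\<^sup>m\<close> walks, since the displacement is always even.\<close>

fun cyclic_walks :: "nat \<Rightarrow> nat \<Rightarrow> int \<Rightarrow> int" where
  "cyclic_walks n 0 x = (if 2 * int n dvd x then 1 else 0)"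
| "cyclic_walks n (Suc r) x = cyclic_walks n r (x - 1) + cyclic_walks n r (x + 1)"

lemma cyclic_walks_periodic: "cyclic_walks n r (x + 2 * int n) = cyclic_walks n r x"
proof (induction r arbitrary: x)
  case (Suc r)
  then show ?case
    using Suc[of "x - 1"] Suc[of "x + 1"] by (simp add: algebra_simps)
qed simp

text \<open>\<open>j\<close> is the number of \<open>+1\<close> steps: a walk from \<open>x\<close>
  with \<open>j\<close> of them ends at \<open>x + 2 * j - r\<close>, and it is counted if that is a
  multiple of \<open>2 * n\<close>. Pascal's rule drives the induction.\<close>

lemma cyclic_walks_eq_sum:
  "cyclic_walks n r x =
    (\<Sum>j\<le>r. if 2 * int n dvd x + 2 * int j - int r then int (r choose j) else 0)"
proof (induction r arbitrary: x)
  case (Suc r)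
  define g where "g j = (2 * int n dvd x + 2 * int j - int (Suc r))" for j
  \<comment> \<open>The two sums belong to a first step \<open>-1\<close> and a first step
    \<open>+1\<close>. In the former the top term will vanish, since \<open>r choose Suc r\<close>
    is zero.\<close>
  have "(\<Sum>j\<le>Suc r. if g j then int (Suc r choose j) else 0)
      = (\<Sum>j\<le>Suc r. if g j then int (r choose j) else 0)
        + (\<Sum>j\<le>r. if g (Suc j) then int (r choose j) else 0)"
    unfolding sum.atMost_Suc_shift by (simp add: sum.distrib[symmetric] if_distrib cong: if_cong)
      (auto intro!: sum.cong)
  also have "(\<Sum>j\<le>Suc r. if g j then int (r choose j) else 0)
      = (\<Sum>j\<le>r. if g j then int (r choose j) else 0)"
    by simp
  finally show ?case
    by (simp add: Suc g_def algebra_simps)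
qed simp

text \<open>The shift trades the term \<open>i = 0\<close> for the term \<open>i = n\<close>, and
  periodicity makes these equal.\<close>

lemma sum_cyclic_walks_shift:
  "(\<Sum>i<n. cyclic_walks n r (2 * int i + (c + 2))) = (\<Sum>i<n. cyclic_walks n r (2 * int i + c))"
proof -
  let ?f = "\<lambda>i. cyclic_walks n r (2 * int i + c)"
  have "(\<Sum>i<n. cyclic_walks n r (2 * int i + (c + 2))) + ?f 0 = (\<Sum>i<Suc n. ?f i)"
    unfolding sum.lessThan_Suc_shift by (simp add: algebra_simps)
  also have "?f n = ?f 0"
    using cyclic_walks_periodic[of n r c] by (simp add: algebra_simps)
  then have "(\<Sum>i<Suc n. ?f i) = (\<Sum>i<n. ?f i) + ?f 0"
    by simp
  finally show ?thesis by simp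
qed

text \<open>The offset \<open>c\<close> must vary in the induction, since a step moves it by one;
  parity of \<open>c + r\<close> is preserved. The sums for \<open>c - 1\<close> and
  \<open>c + 1\<close> agree by the shift lemma, so each step doubles the total.\<close>

lemma sum_cyclic_walks:
  assumes "n > 0" "even (c + int r)"
  shows "(\<Sum>i<n. cyclic_walks n r (2 * int i + c)) = 2 ^ r"
  using assms(2)
proof (induction r arbitrary: c)
  case 0
  then obtain d where d: "c = 2 * d" by auto
  \<comment> \<open>Exactly one \<open>i < n\<close> survives: the residue of \<open>- d\<close>
    modulo \<open>n\<close>.\<close>
  have "(2 * int n dvd 2 * int i + c) = (i = nat ((- d) mod int n))" if "i < n" for i
  proof -
    have "(2 * int n dvd 2 * int i + c) = (int n dvd int i - (- d))"
      unfolding d using dvd_mult_cancel_left[of 2 "int n" "int i + d"] by (simp add: distrib_left)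
    also have "\<dots> = (int i mod int n = (- d) mod int n)"
      by (rule mod_eq_dvd_iff[symmetric])
    also have "\<dots> = (i = nat ((- d) mod int n))"
      using that by auto
    finally show ?thesis .
  qed
  then have "(\<Sum>i<n. cyclic_walks n 0 (2 * int i + c)) =
      (\<Sum>i<n. if i = nat ((- d) mod int n) then 1 else 0)"
    by (intro sum.cong) auto
  also have "\<dots> = 1"
    using assms(1) by (simp add: nat_less_iff)
  finally show ?case by simp
next
  case (Suc r)
  have "(\<Sum>i<n. cyclic_walks n (Suc r) (2 * int i + c))
     = (\<Sum>i<n. cyclic_walks n r (2 * int i + (c - 1))) + (\<Sum>i<n. cyclic_walks n r (2 * int i + (c + 1)))"
    by (simp add: sum.distrib algebra_simps)
  also have "(\<Sum>i<n. cyclic_walks n r (2 * int i + (c + 1))) = (\<Sum>i<n. cyclic_walks n r (2 * int i + (c - 1)))"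
    using sum_cyclic_walks_shift[of n r "c - 1"] by (simp add: algebra_simps)
  finally show ?case
    using Suc by simp
qed

text \<open>At \<open>x = 0\<close> the surviving indices are those congruent to \<open>m\<close>
  modulo \<open>n\<close>. They lie symmetrically about \<open>m\<close>, and symmetry of the
  binomials folds the upper half onto the lower, whence the factor 2.\<close>

lemma cyclic_walks_return:
  assumes "n > 0"
  shows "cyclic_walks n (2 * m) 0 =
    int ((2 * m) choose m) + 2 * (\<Sum>k = 1..m div n. int ((2 * m) choose (m - k * n)))"
proof -
  let ?b = "\<lambda>j. int ((2 * m) choose j)"
  let ?K = "{1..m div n}"
  let ?L = "(\<lambda>k. m - k * n) ` ?K" and ?R = "(\<lambda>k. m + k * n) ` ?K"
  \<comment> \<open>This keeps the natural subtraction \<open>m - k * n\<close> from being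
    truncated.\<close>
  have le: "k * n \<le> m" if "k \<in> ?K" for k
    using that assms by (simp add: less_eq_div_iff_mult_less_eq)
  have dvd: "(2 * int n dvd 2 * int j - 2 * int m) = (int n dvd int j - int m)" for j
    using dvd_mult_cancel_left[of 2 "int n" "int j - int m"] by (simp add: right_diff_distrib)
  have eq: "{j \<in> {..2 * m}. int n dvd int j - int m} = {m} \<union> ?L \<union> ?R"
  proof (intro equalityI subsetI)
    fix j assume "j \<in> {j \<in> {..2 * m}. int n dvd int j - int m}"
    then have j: "j \<le> 2 * m" "int n dvd int j - int m" by auto
    consider "j = m" | "j < m" | "j > m" by linarith
    then show "j \<in> {m} \<union> ?L \<union> ?R"
    proof cases
      case 2
      then have "n dvd m - j"
        using j(2) by (metis dvd_diff_commute int_dvd_int_iff less_imp_le of_nat_diff)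
      then obtain k where k: "m - j = n * k" by blast
      have "k \<in> ?K"
        using k 2 assms by (auto simp: less_eq_div_iff_mult_less_eq mult.commute Suc_le_eq intro: gr0I)
      moreover have "j = m - k * n" using k 2 by (simp add: mult.commute)
      ultimately show ?thesis by blast
    next
      case 3
      then have "n dvd j - m"
        using j(2) by (metis int_dvd_int_iff less_imp_le of_nat_diff)
      then obtain k where k: "j - m = n * k" by blast
      have "k \<in> ?K"
        using k 3 j(1) assms by (auto simp: less_eq_div_iff_mult_less_eq mult.commute Suc_le_eq intro: gr0I)
      moreover have "j = m + k * n" using k 3 by (simp add: mult.commute)
      ultimately show ?thesis by blast
    qed simp
  next
    fix j assume "j \<in> {m} \<union> ?L \<union> ?R"
    then show "j \<in> {j \<in> {..2 * m}. int n dvd int j - int m}"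
      using le by (auto simp: of_nat_diff)
  qed
  have pos: "k * n > 0" if "k \<in> ?K" for k
    using that assms by simp
  have inj: "inj_on (\<lambda>k. m - k * n) ?K" "inj_on (\<lambda>k. m + k * n) ?K"
    using assms le by (auto intro!: inj_onI) (metis diff_diff_cancel le atLeastAtMost_iff mult_right_cancel One_nat_def neq0_conv)
  have disj: "m \<notin> ?L" "m \<notin> ?R" "?L \<inter> ?R = {}"
    using pos le by fastforce+
  have "cyclic_walks n (2 * m) 0 = (\<Sum>j\<le>2 * m. if int n dvd int j - int m then ?b j else 0)"
    using dvd by (simp add: cyclic_walks_eq_sum)
  also have "\<dots> = (\<Sum>j \<in> {m} \<union> ?L \<union> ?R. ?b j)"
    unfolding eq[symmetric] by (rule sum.inter_filter[symmetric]) simp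
  also have "\<dots> = ?b m + (\<Sum>j \<in> ?L. ?b j) + (\<Sum>j \<in> ?R. ?b j)"
    using disj by (subst sum.union_disjoint) auto
  also have "(\<Sum>j \<in> ?L. ?b j) = (\<Sum>k \<in> ?K. ?b (m - k * n))"
    using inj(1) by (simp add: sum.reindex)
  also have "(\<Sum>j \<in> ?R. ?b j) = (\<Sum>k \<in> ?K. ?b (m + k * n))"
    using inj(2) by (simp add: sum.reindex)
  also have "\<dots> = (\<Sum>k \<in> ?K. ?b (m - k * n))"
  proof (rule sum.cong)
    fix k assume "k \<in> ?K"
    then show "?b (m + k * n) = ?b (m - k * n)"
      using le[of k] binomial_symmetric[of "m + k * n" "2 * m"] by (simp add: mult_2)
  qed simp
  finally show ?thesis by simp
qed

text \<open>Both ends are free because removing the first step of a closed walk leaves a walk that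
  need not be closed.\<close>

definition walks_between :: "('a, 'b) pre_digraph \<Rightarrow> nat \<Rightarrow> 'a \<Rightarrow> 'a \<Rightarrow> 'a vwalk set" where
  "walks_between G r u v = {w. vwalk w G \<and> vwalk_length w = r \<and> hd w = u \<and> last w = v}"

lemma finite_walks_between:
  assumes "finite (verts G)"
  shows "finite (walks_between G r u v)"
  by (rule finite_subset[OF _ finite_lists_length_le[OF assms, of "Suc r"]])
    (auto simp: walks_between_def vwalk_def)

text \<open>Supplies the zero boundary values at \<open>0\<close> and \<open>n\<close>, which are
  not vertices of \<open>path_graph (n - 1)\<close>.\<close>

lemma walks_between_eq_empty: "u \<notin> verts G \<Longrightarrow> walks_between G r u v = {}"
  using hd_in_set by (fastforce simp: walks_between_def vwalk_def)

lemma walks_between_0: "u \<in> verts G \<Longrightarrow> walks_between G 0 u v = (if u = v then {[u]} else {})"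
  by (auto simp: walks_between_def vwalk_def le_Suc_eq length_Suc_conv)

lemma walks_between_Suc:
  assumes "u \<in> verts G"
  shows "walks_between G (Suc r) u v =
    (\<Union>u' \<in> {u'. (u, u') \<in> arcs_ends G}. (#) u ` walks_between G r u' v)"
proof (intro equalityI subsetI)
  fix w assume "w \<in> walks_between G (Suc r) u v"
  then obtain u' w' where "w = u # u' # w'" "vwalk w G" "vwalk_length w = Suc r" "last w = v"
    by (cases w rule: vwalk_arcs.cases) (auto simp: walks_between_def)
  then show "w \<in> (\<Union>u' \<in> {u'. (u, u') \<in> arcs_ends G}. (#) u ` walks_between G r u' v)"
    by (auto simp: walks_between_def vwalk_def)
next
  fix w assume "w \<in> (\<Union>u' \<in> {u'. (u, u') \<in> arcs_ends G}. (#) u ` walks_between G r u' v)"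
  then obtain u' w' where w: "w = u # w'" "(u, u') \<in> arcs_ends G" "vwalk w' G"
      "vwalk_length w' = r" "hd w' = u'" "last w' = v"
    by (auto simp: walks_between_def)
  then show "w \<in> walks_between G (Suc r) u v"
    using assms by (cases w') (auto simp: walks_between_def vwalk_def)
qed

text \<open>The start \<open>i\<close> ranges over the closed interval from \<open>0\<close> to
  \<open>n\<close>, so that both neighbours of an interior vertex fall under the induction
  hypothesis. On the right, the two terms coincide at \<open>i = 0\<close> and have arguments
  differing by \<open>2 * n\<close> at \<open>i = n\<close>.\<close>

lemma card_walks_between_path_graph:
  assumes "i \<le> n" "0 < j" "j < n"
  shows "int (card (walks_between (path_graph (n - 1)) r i j)) =
    cyclic_walks n r (int j - int i) - cyclic_walks n r (int j + int i)"
  using assms(1)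
proof (induction r arbitrary: i)
  case (0 i)
  \<comment> \<open>Both \<open>j - i\<close> and \<open>j + i\<close> have absolute value below
    \<open>2 * n\<close>, and \<open>j + i\<close> is positive.\<close>
  have "2 * int n dvd int j - int i \<longleftrightarrow> i = j"
    using 0 assms dvd_imp_le_int[of "int j - int i" "2 * int n"] by (cases "i = j") auto
  moreover have "\<not> 2 * int n dvd int j + int i"
    using 0 assms zdvd_not_zless[of "int j + int i" "2 * int n"] by simp
  moreover have "i \<in> verts (path_graph (n - 1)) \<longleftrightarrow> i \<in> {1..<n}"
    using assms by (auto simp: path_graph_def)
  ultimately show ?case
    using assms by (cases "i \<in> {1..<n}") (auto simp: walks_between_0 walks_between_eq_empty)
next
  case (Suc r)
  let ?G = "with_proj (path_graph (n - 1))"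
  consider "i = 0" | "i = n" | "0 < i" "i < n" using Suc.prems by linarith
  then show ?case
  proof cases
    case 1
    then show ?thesis by (simp add: walks_between_eq_empty path_graph_def)
  next
    case 2
    then show ?thesis
      using assms cyclic_walks_periodic[of n "Suc r" "int j - int n"]
      by (simp add: walks_between_eq_empty path_graph_def add.commute del: cyclic_walks.simps)
  next
    case 3
    have fin: "finite (walks_between ?G r u v)" for u v
      by (rule finite_walks_between) (simp add: path_graph_def)
    have ends: "(i, u') \<in> arcs_ends ?G \<longleftrightarrow> u' \<in> verts ?G \<and> u' \<in> {i - 1, i + 1}" for u'
      using 3 by (auto simp: arcs_ends_def arc_to_ends_def path_graph_def)
    have "i \<in> verts ?G" using 3 by (simp add: path_graph_def)
    then have "walks_between ?G (Suc r) i j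
        = (\<Union>u' \<in> {u'. u' \<in> verts ?G \<and> u' \<in> {i - 1, i + 1}}. (#) i ` walks_between ?G r u' j)"
      by (simp only: walks_between_Suc ends)
    \<comment> \<open>A neighbour that is not a vertex contributes the empty set, so the union may
      run over both \<open>i - 1\<close> and \<open>i + 1\<close>.\<close>
    also have "\<dots> = (#) i ` (walks_between ?G r (i - 1) j \<union> walks_between ?G r (i + 1) j)"
      using walks_between_eq_empty[of _ ?G r j] by blast
    also have "card \<dots> = card (walks_between ?G r (i - 1) j \<union> walks_between ?G r (i + 1) j)"
      by (rule card_image) simp
    also have "\<dots> = card (walks_between ?G r (i - 1) j) + card (walks_between ?G r (i + 1) j)"
      using 3 by (intro card_Un_disjoint fin) (auto simp: walks_between_def)
    finally have card: "card (walks_between ?G (Suc r) i j)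
        = card (walks_between ?G r (i - 1) j) + card (walks_between ?G r (i + 1) j)" .
    have "i - 1 \<le> n" "i + 1 \<le> n" using 3 by auto
    then show ?thesis
      using 3 card Suc.IH[of "i - 1"] Suc.IH[of "i + 1"] by (simp add: of_nat_diff algebra_simps)
  qed
qed

lemma num_closed_walks_eq_sum:
  assumes "finite (verts G)"
  shows "num_closed_walks G r = (\<Sum>v \<in> verts G. card (walks_between G r v v))"
proof -
  have "closed_walks G r = (\<Union>v \<in> verts G. walks_between G r v v)"
    using hd_in_set by (fastforce simp: closed_walks_def walks_between_def vwalk_def)
  moreover have "card (\<Union>v \<in> verts G. walks_between G r v v)
      = (\<Sum>v \<in> verts G. card (walks_between G r v v))"
    using assms by (intro card_UN_disjoint) (auto simp: finite_walks_between, auto simp: walks_between_def)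
  ultimately show ?thesis by (simp add: num_closed_walks_def)
qed

lemma num_closed_walks_path_graph:
  assumes "n > 0"
  shows "int (num_closed_walks (path_graph (n - 1)) (2 * m)) =
    int n * cyclic_walks n (2 * m) 0 - 2 ^ (2 * m)"
proof -
  let ?c = "cyclic_walks n (2 * m)"
  have "int (num_closed_walks (path_graph (n - 1)) (2 * m))
      = (\<Sum>i = 1..n - 1. int (card (walks_between (path_graph (n - 1)) (2 * m) i i)))"
    by (subst num_closed_walks_eq_sum) (auto simp: path_graph_def)
  also have "\<dots> = (\<Sum>i = 1..n - 1. ?c 0 - ?c (2 * int i))"
    using assms by (intro sum.cong refl) (subst card_walks_between_path_graph, auto)
  \<comment> \<open>The added term \<open>i = 0\<close> is zero; it completes the range of
    \<open>i\<close> to all residues modulo \<open>n\<close>.\<close>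
  also have "\<dots> = (\<Sum>i<n. ?c 0 - ?c (2 * int i))"
    by (rule sum.mono_neutral_left) (auto simp: Suc_le_eq)
  also have "\<dots> = int n * ?c 0 - 2 ^ (2 * m)"
    using sum_cyclic_walks[of n 0 "2 * m"] assms by (simp add: sum_subtractf)
  finally show ?thesis .
qed

theorem theorem5p1:
  fixes n m :: nat
  assumes "n \<ge> 2" and "m \<ge> 1"
  shows "int (num_closed_walks (path_graph (n - 1)) (2 * m)) =
    (if m \<ge> n
     then 2 * int n * (int ((2 * m - 1) choose (m - 1)) +
            (\<Sum>k = 1..m div n. int ((2 * m) choose (m - k * n)))) - 2 ^ (2 * m)
     else 2 * int n * int ((2 * m - 1) choose (m - 1)) - 2 ^ (2 * m))"
proof -
  \<comment> \<open>Pascal's rule splits the central binomial into two equal halves, giving the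
    common factor 2 of the formula.\<close>
  have "(2 * m) choose m = ((2 * m - 1) choose (m - 1)) + ((2 * m - 1) choose m)"
    using assms(2) choose_reduce_nat[of "2 * m" m] by simp
  also have "(2 * m - 1) choose m = (2 * m - 1) choose (m - 1)"
    using assms(2) binomial_symmetric[of m "2 * m - 1"] by (simp add: mult_2)
  finally have "int ((2 * m) choose m) = 2 * int ((2 * m - 1) choose (m - 1))"
    by simp
  moreover have "n > 0" using assms(1) by simp
  \<comment> \<open>For \<open>m < n\<close> the quotient \<open>m div n\<close> is zero and the sum
    is empty, so one formula yields both cases.\<close>
  ultimately show ?thesis
    unfolding num_closed_walks_path_graph[OF \<open>n > 0\<close>] cyclic_walks_return[OF \<open>n > 0\<close>]
    by (simp add: algebra_simps)
qed

end
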